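(* Let $G$ and $H$ be finite simple graphs which are homeomorphic, i.e. $G$ and $H$ can be equipped with graph topologies such that the resulting topological graphs $(G,\mathcal{B},\mathcal{O})$ and $(H,\mathcal{C},\mathcal{P})$ are homeomorphic. Then $G$ and $H$ are homotopic.
   Context: All graphs are finite and simple. For a vertex $x$ of a graph $G=(V,E)$, the unit sphere $S(x)$ is the subgraph of $G$ generated (induced) by all vertices adjacent to $x$. The intersection of two subgraphs is the subgraph formed by their common vertices and common edges; a subgraph is also regarded as the set of its vertices when speaking of topologies on $V$. Dimension: $\dim(\emptyset)=-1$ and inductively $\dim(G)=\frac{1}{|V|}\sum_{x\in V}(1+\dim(S(x)))$. Homotopy: the one-point graph $K_1$ is contractible. A homotopy extension of a graph selects a contractible (induced) subgraph $H$ and adds a new vertex $z$ connected exactly to all vertices of $H$ (so $S(z)=H$). The reverse step removes a vertex $z$ with contractible unit sphere $S(z)$, together with all edges at $z$. Two graphs are homotopic if one can be obtained from the other by a finite sequence of such steps; a graph is contractible if it is homotopic to $K_1$. (This is an inductive definition.) Graph topology: two subgraphs $A,B$ satisfy the dimension assumption if $\dim(A\cap B)\ge \min(\dim(A),\dim(B))$, where the dimensions are those of these subgraphs as graphs themselves. A topology $\mathcal{O}$ on $V$ is a graph topology on $G=(V,E)$ if it has a sub-base $\mathcal{B}$ consisting of contractible subgraphs of $G$ such that (i) the intersection of any two elements of $\mathcal{B}$ satisfying the dimension assumption is contractible; (ii) every edge of $G$ is contained in some $B\in\mathcal{B}$; (iii) the nerve graph $\mathcal{G}=(\mathcal{B},\mathcal{E})$,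 whose vertices are the elements of $\mathcal{B}$ and whose edges are the pairs of distinct $A,B\in\mathcal{B}$ satisfying the dimension assumption, is homotopic to $G$. A graph with such a topology, written $(G,\mathcal{B},\mathcal{O})$, is a topological graph. Homeomorphism: given topological graphs $(G,\mathcal{B},\mathcal{O})$ and $(H,\mathcal{C},\mathcal{P})$ with nerve graphs $\mathcal{G},\mathcal{H}$, a map $\phi:\mathcal{O}\to\mathcal{P}$ is continuous if it induces a graph homomorphism $\mathcal{G}\to\mathcal{H}$ (it maps each $A\in\mathcal{B}$ to an element $\phi(A)\in\mathcal{C}$, edges of the nerve going to edges) such that $\dim(\phi(A))\le\dim(A)$ for every $A\in\mathcal{B}$. If $\phi$ has an inverse which is also continuous, $\phi$ is a graph homeomorphism and the topological graphs are homeomorphic. *)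

theory Defs
  imports "HOL-Analysis.Abstract_Topology"
begin

datatype 'a graph = Graph (verts: "'a set") (edges: "'a set set")

definition simple_graph :: "'a graph \<Rightarrow> bool" where
  "simple_graph G \<longleftrightarrow> finite (verts G) \<and>
     edges G \<subseteq> {{x, y} | x y. x \<in> verts G \<and> y \<in> verts G \<and> x \<noteq> y}"

definition subgraph :: "'a graph \<Rightarrow> 'a graph \<Rightarrow> bool" where
  "subgraph A G \<longleftrightarrow> simple_graph A \<and> verts A \<subseteq> verts G \<and> edges A \<subseteq> edges G"

definition induced :: "'a graph \<Rightarrow> 'a set \<Rightarrow> 'a graph" where
  "induced G W = Graph W {e \<in> edges G. e \<subseteq> W}"

definition graph_inter :: "'a graph \<Rightarrow> 'a graph \<Rightarrow> 'a graph" where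
  "graph_inter A B = Graph (verts A \<inter> verts B) (edges A \<inter> edges B)"

definition unit_sphere :: "'a graph \<Rightarrow> 'a \<Rightarrow> 'a graph" where
  "unit_sphere G x = induced G {y \<in> verts G. {x, y} \<in> edges G}"

lemma card_unit_sphere_less:
  assumes "simple_graph G" "x \<in> verts G"
  shows "card (verts (unit_sphere G x)) < card (verts G)"
proof -
  have "x \<notin> verts (unit_sphere G x)"
    using assms by (auto simp: unit_sphere_def induced_def simple_graph_def)
  moreover have "verts (unit_sphere G x) \<subseteq> verts G"
    by (auto simp: unit_sphere_def induced_def)
  ultimately show ?thesis
    using assms by (intro psubset_card_mono) (auto simp: simple_graph_def)
qed

(* Only the values on simple graphs matter; the guard is there for termination. *)
function graph_dim :: "'a graph \<Rightarrow> real" where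
  "graph_dim G =
     (if simple_graph G \<and> verts G \<noteq> {}
      then (\<Sum>x\<in>verts G. 1 + graph_dim (unit_sphere G x)) / real (card (verts G))
      else - 1)"
  by auto
termination
  by (relation "Wellfounded.measure (\<lambda>G. card (verts G))") (auto intro: card_unit_sphere_less)

declare graph_dim.simps [simp del]

definition add_vertex :: "'a graph \<Rightarrow> 'a set \<Rightarrow> 'a \<Rightarrow> 'a graph" where
  "add_vertex G W z = Graph (insert z (verts G)) (edges G \<union> {{z, w} | w. w \<in> W})"

definition remove_vertex :: "'a graph \<Rightarrow> 'a \<Rightarrow> 'a graph" where
  "remove_vertex G z = induced G (verts G - {z})"

(* Homotopy steps need an unlimited supply of new vertices and must compare graphs with
   different vertex types (a graph and its nerve).  So they are performed on graphs with
   vertices in nat, and other graphs are compared through copies there. *)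
inductive nat_contractible :: "nat graph \<Rightarrow> bool"
  and nat_homotopic :: "nat graph \<Rightarrow> nat graph \<Rightarrow> bool"
where
  contractible: "nat_homotopic G (Graph {x} {}) \<Longrightarrow> nat_contractible G"
| refl: "simple_graph G \<Longrightarrow> nat_homotopic G G"
| extension: "nat_homotopic G H \<Longrightarrow> W \<subseteq> verts H \<Longrightarrow> nat_contractible (induced H W) \<Longrightarrow>
    z \<notin> verts H \<Longrightarrow> nat_homotopic G (add_vertex H W z)"
| reduction: "nat_homotopic G H \<Longrightarrow> z \<in> verts H \<Longrightarrow> nat_contractible (unit_sphere H z) \<Longrightarrow>
    nat_homotopic G (remove_vertex H z)"

definition rename :: "('a \<Rightarrow> 'b) \<Rightarrow> 'a graph \<Rightarrow> 'b graph" where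
  "rename f G = Graph (f ` verts G) ((`) f ` edges G)"

definition graph_contractible :: "'a graph \<Rightarrow> bool" where
  "graph_contractible G \<longleftrightarrow>
     (\<exists>f. inj_on f (verts G) \<and> nat_contractible (rename f G))"

definition graph_homotopic :: "'a graph \<Rightarrow> 'b graph \<Rightarrow> bool" where
  "graph_homotopic G H \<longleftrightarrow>
     (\<exists>f g. inj_on f (verts G) \<and> inj_on g (verts H) \<and>
        nat_homotopic (rename f G) (rename g H))"

definition dim_assumption :: "'a graph \<Rightarrow> 'a graph \<Rightarrow> bool" where
  "dim_assumption A B \<longleftrightarrow>
     graph_dim (graph_inter A B) \<ge> min (graph_dim A) (graph_dim B)"

definition nerve :: "'a graph set \<Rightarrow> 'a graph graph" where
  "nerve \<B> = Graph \<B> {{A, B} | A B. A \<in> \<B> \<and> B \<in> \<B> \<and> A \<noteq> B \<and> dim_assumption A B}"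

(* The open sets are the unions of finite intersections of members of the sub-base; the empty
   intersection is the whole vertex set, so a sub-base need not cover isolated vertices. *)
definition subbase_of :: "'a set \<Rightarrow> 'a set set \<Rightarrow> 'a topology \<Rightarrow> bool" where
  "subbase_of V \<S> T \<longleftrightarrow>
     openin T = arbitrary union_of (finite intersection_of (\<lambda>S. S \<in> \<S>) relative_to V)"

definition topological_graph :: "'a graph \<Rightarrow> 'a graph set \<Rightarrow> 'a topology \<Rightarrow> bool" where
  "topological_graph G \<B> T \<longleftrightarrow>
     simple_graph G \<and>
     (\<forall>A\<in>\<B>. subgraph A G \<and> graph_contractible A) \<and>
     subbase_of (verts G) (verts ` \<B>) T \<and>
     (\<forall>A\<in>\<B>. \<forall>B\<in>\<B>. dim_assumption A B \<longrightarrow> graph_contractible (graph_inter A B)) \<and>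
     (\<forall>e\<in>edges G. \<exists>A\<in>\<B>. e \<in> edges A) \<and>
     graph_homotopic (nerve \<B>) G"

definition graph_hom :: "('a \<Rightarrow> 'b) \<Rightarrow> 'a graph \<Rightarrow> 'b graph \<Rightarrow> bool" where
  "graph_hom f G H \<longleftrightarrow>
     (\<forall>x\<in>verts G. f x \<in> verts H) \<and> (\<forall>x y. {x, y} \<in> edges G \<longrightarrow> {f x, f y} \<in> edges H)"

(* Members of a sub-base are subgraphs while open sets are vertex sets, and subgraphs need not
   be induced.  Hence a map phi of open sets comes with the map F it induces on the sub-bases,
   where F and phi agree under identifying a subgraph with its vertex set.  If distinct members
   of the target sub-base have distinct vertex sets, F is determined there by phi. *)
definition graph_continuous ::
  "'a graph set \<Rightarrow> 'a topology \<Rightarrow> 'b graph set \<Rightarrow> 'b topology \<Rightarrow>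
   ('a set \<Rightarrow> 'b set) \<Rightarrow> ('a graph \<Rightarrow> 'b graph) \<Rightarrow> bool" where
  "graph_continuous \<B> T \<C> U \<phi> F \<longleftrightarrow>
     (\<forall>S. openin T S \<longrightarrow> openin U (\<phi> S)) \<and>
     (\<forall>A\<in>\<B>. verts (F A) = \<phi> (verts A)) \<and>
     graph_hom F (nerve \<B>) (nerve \<C>) \<and>
     (\<forall>A\<in>\<B>. graph_dim (F A) \<le> graph_dim A)"

definition graph_homeomorphism ::
  "'a graph set \<Rightarrow> 'a topology \<Rightarrow> 'b graph set \<Rightarrow> 'b topology \<Rightarrow>
   ('a set \<Rightarrow> 'b set) \<Rightarrow> ('a graph \<Rightarrow> 'b graph) \<Rightarrow> bool" where
  "graph_homeomorphism \<B> T \<C> U \<phi> F \<longleftrightarrow>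
     graph_continuous \<B> T \<C> U \<phi> F \<and>
     (\<exists>\<psi> F'. graph_continuous \<C> U \<B> T \<psi> F' \<and>
        (\<forall>S. openin T S \<longrightarrow> \<psi> (\<phi> S) = S) \<and> (\<forall>S. openin U S \<longrightarrow> \<phi> (\<psi> S) = S) \<and>
        (\<forall>A\<in>\<B>. F' (F A) = A) \<and> (\<forall>A\<in>\<C>. F (F' A) = A))"

definition graph_homeomorphic :: "'a graph \<Rightarrow> 'b graph \<Rightarrow> bool" where
  "graph_homeomorphic G H \<longleftrightarrow>
     (\<exists>\<B> T \<C> U \<phi> F. topological_graph G \<B> T \<and> topological_graph H \<C> U \<and>
        graph_homeomorphism \<B> T \<C> U \<phi> F)"

end

theory Submission imports Defs begin

text \<open>A homeomorphism restricts to an isomorphism of the nerve graphs, so \<open>G\<close> and \<open>H\<close> are homotopic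
to copies of one nerve.  It remains to see that homotopy is symmetric (an extension and
the corresponding reduction undo each other), transitive, and invariant under injective renaming of
the vertices.\<close>

section \<open>Renaming of vertices and its effect on the graph operations\<close>

lemma rename_rename: "rename f (rename g G) = rename (f \<circ> g) G"
  by (simp add: rename_def image_comp comp_def)

lemma rename_cong:
  assumes "\<And>x. x \<in> verts G \<Longrightarrow> f x = g x" and "\<And>e. e \<in> edges G \<Longrightarrow> e \<subseteq> verts G"
  shows "rename f G = rename g G"
proof -
  have "f ` e = g ` e" if "e \<in> edges G" for e
    using assms that by (intro image_cong) auto
  then show ?thesis
    using assms(1) by (simp add: rename_def cong: image_cong)
qed

lemma simple_graph_edge_subset: "simple_graph G \<Longrightarrow> e \<in> edges G \<Longrightarrow> e \<subseteq> verts G"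
  by (auto simp: simple_graph_def)

lemma simple_graph_rename:
  assumes "inj f" "simple_graph G"
  shows "simple_graph (rename f G)"
proof -
  have "f ` e \<in> {{x, y} | x y. x \<in> f ` verts G \<and> y \<in> f ` verts G \<and> x \<noteq> y}" if e: "e \<in> edges G" for e
  proof -
    obtain x y where "e = {x, y}" "x \<in> verts G" "y \<in> verts G" "x \<noteq> y"
      using e assms(2) unfolding simple_graph_def by blast
    then have "f ` e = {f x, f y}" "f x \<in> f ` verts G" "f y \<in> f ` verts G" "f x \<noteq> f y"
      using assms(1) by (simp_all add: inj_eq)
    then show ?thesis
      by blast
  qed
  then show ?thesis
    using assms(2) unfolding simple_graph_def rename_def by (simp add: image_subset_iff)
qed

lemma rename_induced: "inj f \<Longrightarrow> rename f (induced G W) = induced (rename f G) (f ` W)"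
  by (auto simp: rename_def induced_def inj_image_subset_iff)

lemma rename_add_vertex:
  "rename f (add_vertex G W z) = add_vertex (rename f G) (f ` W) (f z)"
proof -
  have "(`) f ` {{z, w} | w. w \<in> W} = {{f z, w} | w. w \<in> f ` W}"
    by (simp add: Setcompr_eq_image image_image)
  then show ?thesis
    by (simp add: rename_def add_vertex_def image_Un)
qed

lemma rename_remove_vertex:
  "inj f \<Longrightarrow> rename f (remove_vertex G z) = remove_vertex (rename f G) (f z)"
  by (simp add: remove_vertex_def rename_induced image_set_diff) (simp add: rename_def)

lemma rename_unit_sphere:
  assumes "inj f"
  shows "rename f (unit_sphere G z) = unit_sphere (rename f G) (f z)"
proof -
  have "{f z, f y} \<in> (`) f ` edges G \<longleftrightarrow> {z, y} \<in> edges G" for y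
  proof -
    \<comment> \<open>The image map on vertex sets is injective too, so an edge of the renamed graph
      comes from only one set: adjacency to \<open>f z\<close> reflects adjacency to
      \<open>z\<close>.\<close>
    have "inj ((`) f)"
      using assms by (simp add: inj_on_def inj_image_eq_iff)
    from inj_image_mem_iff[OF this, of "{z, y}"] show ?thesis
      by simp
  qed
  then have "f ` {y \<in> verts G. {z, y} \<in> edges G} =
      {y \<in> verts (rename f G). {f z, y} \<in> edges (rename f G)}"
    by (auto simp: rename_def)
  then show ?thesis
    using assms by (simp add: unit_sphere_def rename_induced)
qed

section \<open>Adding and removing a vertex as mutually inverse operations\<close>

lemma simple_graph_add_vertex:
  assumes "simple_graph G" "W \<subseteq> verts G" "z \<notin> verts G"
  shows "simple_graph (add_vertex G W z)"
proof -
  have "{z, w} \<in> {{x, y} | x y. x \<in> insert z (verts G) \<and> y \<in> insert z (verts G) \<and> x \<noteq> y}"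
    if "w \<in> W" for w
    using assms that by blast
  then show ?thesis
    using assms unfolding simple_graph_def add_vertex_def by fastforce
qed

lemma simple_graph_remove_vertex: "simple_graph G \<Longrightarrow> simple_graph (remove_vertex G z)"
  unfolding simple_graph_def remove_vertex_def induced_def by clarsimp blast

text \<open>In a simple graph every edge lies inside the vertex set, so no old edge contains the
  fresh \<open>z\<close> and removal deletes exactly the added edges.\<close>

lemma remove_add_vertex:
  assumes "simple_graph G" "z \<notin> verts G"
  shows "remove_vertex (add_vertex G W z) z = G"
proof -
  have "{e \<in> edges G \<union> {{z, w} | w. w \<in> W}. e \<subseteq> verts G} = edges G"
    using assms simple_graph_edge_subset by fastforce
  then show ?thesis
    using assms(2) by (cases G) (simp add: remove_vertex_def add_vertex_def induced_def)
qed

text \<open>Turns the contractibility premise of an extension into that of the reduction undoing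
  it.\<close>

lemma unit_sphere_add_vertex:
  assumes "simple_graph G" "W \<subseteq> verts G" "z \<notin> verts G"
  shows "unit_sphere (add_vertex G W z) z = induced G W"
proof -
  have "{z, y} \<notin> edges G" for y
    using assms simple_graph_edge_subset by fastforce
  then have "{y \<in> verts (add_vertex G W z). {z, y} \<in> edges (add_vertex G W z)} = W"
    using assms by (auto simp: add_vertex_def doubleton_eq_iff)
  moreover have "induced (add_vertex G W z) W = induced G W"
    using assms by (auto simp: induced_def add_vertex_def)
  ultimately show ?thesis
    by (simp add: unit_sphere_def)
qed

lemma notin_verts_unit_sphere: "simple_graph G \<Longrightarrow> z \<notin> verts (unit_sphere G z)"
  by (auto simp: simple_graph_def unit_sphere_def induced_def)

lemma induced_remove_vertex:
  "W \<subseteq> verts G - {z} \<Longrightarrow> induced (remove_vertex G z) W = induced G W"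
  by (auto simp: induced_def remove_vertex_def)

text \<open>Removing \<open>z\<close> loses just the edges at \<open>z\<close>, and these are
  recovered from its neighbours.\<close>

lemma add_remove_vertex:
  assumes "simple_graph G" "z \<in> verts G"
  shows "add_vertex (remove_vertex G z) (verts (unit_sphere G z)) z = G"
proof -
  have "e \<in> {{z, w} | w. w \<in> verts G \<and> {z, w} \<in> edges G}"
    if e: "e \<in> edges G" "\<not> e \<subseteq> verts G - {z}" for e
  proof -
    obtain x y where "e = {x, y}" "x \<in> verts G" "y \<in> verts G"
      using e(1) assms(1) by (auto simp: simple_graph_def)
    with e show ?thesis
      by (auto simp: insert_commute)
  qed
  then have "{e \<in> edges G. e \<subseteq> verts G - {z}} \<union>
      {{z, w} | w. w \<in> verts G \<and> {z, w} \<in> edges G} = edges G"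
    by auto
  then show ?thesis
    using assms(2)
    by (cases G) (simp add: add_vertex_def remove_vertex_def unit_sphere_def induced_def insert_absorb)
qed

section \<open>Homotopy on the naturals: equivalence and invariance under renaming\<close>

lemma nat_homotopic_simple:
  "nat_homotopic G H \<Longrightarrow> simple_graph G \<and> simple_graph H"
  \<comment> \<open>The definition is mutual, so its induction rule wants a predicate for
    contractibility as well; the trivial one leaves an induction on homotopy alone.\<close>
  by (induction rule: nat_contractible_nat_homotopic.inducts(2)[where ?P1.0 = "\<lambda>_. True"])
    (simp_all add: simple_graph_add_vertex simple_graph_remove_vertex)

text \<open>Steps act on the right-hand graph only, so those from \<open>H\<close> to
  \<open>K\<close> are replayed after a homotopy ending in \<open>H\<close>. The homotopy inducted
  on is stated first.\<close>

lemma nat_homotopic_trans: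
  assumes "nat_homotopic H K" "nat_homotopic G H"
  shows "nat_homotopic G K"
  using assms
proof (induction rule: nat_contractible_nat_homotopic.inducts(2)[where ?P1.0 = "\<lambda>_. True"])
  case (extension H K W z)
  then show ?case
    by (blast intro: nat_contractible_nat_homotopic.extension)
next
  case (reduction H K z)
  then show ?case
    by (blast intro: nat_contractible_nat_homotopic.reduction)
qed simp_all

text \<open>The inverse of the last step has to come first in the reversed homotopy; transitivity
  puts it in front of the reversal given by induction.\<close>

lemma nat_homotopic_sym:
  "nat_homotopic G H \<Longrightarrow> nat_homotopic H G"
proof (induction rule: nat_contractible_nat_homotopic.inducts(2)[where ?P1.0 = "\<lambda>_. True"])
  case (extension G H W z)
  have H: "simple_graph H"
    using extension nat_homotopic_simple by blast
  have "nat_homotopic (add_vertex H W z) (remove_vertex (add_vertex H W z) z)"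
  proof (intro nat_contractible_nat_homotopic.reduction nat_contractible_nat_homotopic.refl)
    show "simple_graph (add_vertex H W z)"
      using extension H by (simp add: simple_graph_add_vertex)
    show "z \<in> verts (add_vertex H W z)"
      by (simp add: add_vertex_def)
    show "nat_contractible (unit_sphere (add_vertex H W z) z)"
      using extension H by (simp add: unit_sphere_add_vertex)
  qed
  then show ?case
    using nat_homotopic_trans[OF extension.IH(1)] remove_add_vertex[OF H] extension.hyps by simp
next
  case (reduction G H z)
  let ?W = "verts (unit_sphere H z)"
  have H: "simple_graph H"
    using reduction nat_homotopic_simple by blast
  have W: "?W \<subseteq> verts H - {z}"
    using notin_verts_unit_sphere[OF H, of z] by (auto simp: unit_sphere_def induced_def)
  \<comment> \<open>The sphere avoids \<open>z\<close>, so it survives the removal unchanged and is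
    a contractible base for re-adding \<open>z\<close>.\<close>
  have "induced (remove_vertex H z) ?W = unit_sphere H z"
    using W by (simp add: induced_remove_vertex) (simp add: unit_sphere_def induced_def)
  then have "nat_homotopic (remove_vertex H z) (add_vertex (remove_vertex H z) ?W z)"
    using reduction H W simple_graph_remove_vertex
    by (intro nat_contractible_nat_homotopic.extension nat_contractible_nat_homotopic.refl)
      (auto simp: remove_vertex_def induced_def)
  then show ?case
    using nat_homotopic_trans[OF reduction.IH(1)] add_remove_vertex[OF H] reduction.hyps by simp
qed (simp_all add: nat_contractible_nat_homotopic.refl)

text \<open>Intermediate graphs may use vertices outside \<open>G\<close> and \<open>H\<close>;
  global injectivity of \<open>f\<close> keeps every added vertex fresh after renaming.\<close>

lemma nat_homotopic_rename:
  assumes "inj f" "nat_homotopic G H"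
  shows "nat_homotopic (rename f G) (rename f H)"
  using assms(2)
\<comment> \<open>Here the predicate for contractibility is a genuine one: the renamed steps need
  contractible renamed bases and spheres.\<close>
proof (induction rule: nat_contractible_nat_homotopic.inducts(2)
    [where ?P1.0 = "\<lambda>G. nat_contractible (rename f G)"])
  case (contractible G x)
  then show ?case
    by (intro nat_contractible_nat_homotopic.contractible[where x = "f x"]) (simp add: rename_def)
next
  case (refl G)
  then show ?case
    by (intro nat_contractible_nat_homotopic.refl simple_graph_rename assms(1))
next
  case (extension G H W z)
  have "nat_contractible (induced (rename f H) (f ` W))"
    using extension by (simp add: rename_induced assms(1))
  moreover have "f ` W \<subseteq> verts (rename f H)" "f z \<notin> verts (rename f H)"
    using extension.hyps assms(1) by (auto simp: rename_def inj_eq)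
  ultimately show ?case
    unfolding rename_add_vertex
    using extension.IH(1) nat_contractible_nat_homotopic.extension by blast
next
  case (reduction G H z)
  have "nat_contractible (unit_sphere (rename f H) (f z))"
    using reduction by (simp add: rename_unit_sphere assms(1))
  moreover have "f z \<in> verts (rename f H)"
    using reduction.hyps by (simp add: rename_def)
  ultimately show ?case
    unfolding rename_remove_vertex[OF assms(1)]
    using reduction.IH(1) nat_contractible_nat_homotopic.reduction by blast
qed

section \<open>Homotopy of graphs with arbitrary vertex types\<close>

lemma inj_extension_nat:
  fixes p :: "nat \<Rightarrow> nat"
  assumes "finite A" "inj_on p A"
  obtains s where "inj s" "\<And>x. x \<in> A \<Longrightarrow> s x = p x"
proof -
  \<comment> \<open>Off \<open>A\<close> the argument is shifted beyond every value of
    \<open>p\<close> on \<open>A\<close>, so the two branches never collide. For empty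
    \<open>A\<close> the map is still a shift by a constant.\<close>
  define s where "s x = (if x \<in> A then p x else x + Suc (Max (p ` A)))" for x
  have lt: "p x < Suc (Max (p ` A))" if "x \<in> A" for x
    using assms(1) that by (simp add: le_imp_less_Suc)
  have "inj s"
  proof (rule injI)
    fix x y assume "s x = s y"
    then show "x = y"
      using lt[of x] lt[of y] inj_onD[OF assms(2), of x y]
      by (cases "x \<in> A"; cases "y \<in> A") (simp_all add: s_def)
  qed
  moreover have "s x = p x" if "x \<in> A" for x
    using that by (simp add: s_def)
  ultimately show thesis
    by (rule that)
qed

lemma graph_homotopic_sym:
  "graph_homotopic G H \<Longrightarrow> graph_homotopic H G"
  unfolding graph_homotopic_def by (meson nat_homotopic_sym)

text \<open>The middle graph may be copied into the naturals differently by the two hypotheses; the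
injection \<open>s\<close> carries one copy to the other.\<close>

lemma graph_homotopic_trans:
  assumes "graph_homotopic G K" "graph_homotopic K H"
    and edge: "\<And>e. e \<in> edges K \<Longrightarrow> e \<subseteq> verts K"
  shows "graph_homotopic G H"
proof -
  obtain g k where g: "inj_on g (verts G)" and k: "inj_on k (verts K)"
    and GK: "nat_homotopic (rename g G) (rename k K)"
    using assms(1) by (auto simp: graph_homotopic_def)
  obtain l h where l: "inj_on l (verts K)" and h: "inj_on h (verts H)"
    and KH: "nat_homotopic (rename l K) (rename h H)"
    using assms(2) by (auto simp: graph_homotopic_def)
  \<comment> \<open>Finiteness is inherited from the copy of \<open>K\<close>, since homotopy
    relates simple graphs only; it allows the change of copy to be extended to all naturals.\<close>
  have "finite (verts K)"
    using nat_homotopic_simple[OF GK] k by (simp add: simple_graph_def rename_def finite_image_iff)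
  moreover have "inj_on (k \<circ> inv_into (verts K) l) (l ` verts K)"
    using k by (intro comp_inj_on inj_on_inv_into) (auto simp: l)
  ultimately obtain s where s: "inj s"
    and s_eq: "\<And>x. x \<in> l ` verts K \<Longrightarrow> s x = (k \<circ> inv_into (verts K) l) x"
    using inj_extension_nat[of "l ` verts K" "k \<circ> inv_into (verts K) l"] by auto
  \<comment> \<open>\<open>s \<circ> l\<close> is known to agree with \<open>k\<close> on the
    vertices of \<open>K\<close>; \<open>edge\<close> extends the agreement to the images of
    edges.\<close>
  have "rename s (rename l K) = rename k K"
    unfolding rename_rename using edge by (intro rename_cong) (simp_all add: s_eq l)
  moreover have "nat_homotopic (rename s (rename l K)) (rename s (rename h H))"
    using s KH by (rule nat_homotopic_rename)
  ultimately have "nat_homotopic (rename g G) (rename (s \<circ> h) H)"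
    using nat_homotopic_trans[OF _ GK] by (simp add: rename_rename)
  moreover have "inj_on (s \<circ> h) (verts H)"
    using h inj_on_subset[OF s] by (intro comp_inj_on) simp_all
  ultimately show ?thesis
    using g unfolding graph_homotopic_def by blast
qed

text \<open>A copy of the renamed graph in the naturals is also a copy of \<open>G\<close>, by
  composing the injections.\<close>

lemma graph_homotopic_rename_left:
  assumes "inj_on f (verts G)" "graph_homotopic (rename f G) H"
  shows "graph_homotopic G H"
proof -
  obtain g h where "inj_on g (f ` verts G)" and h: "inj_on h (verts H)"
    and GH: "nat_homotopic (rename (g \<circ> f) G) (rename h H)"
    using assms(2) by (auto simp: graph_homotopic_def rename_rename) (simp add: rename_def)
  then have "inj_on (g \<circ> f) (verts G)"
    using assms(1) by (simp add: comp_inj_on)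
  then show ?thesis
    unfolding graph_homotopic_def using h GH by blast
qed

section \<open>Isomorphism of the nerves and conclusion\<close>

text \<open>The right inverse \<open>g\<close> provides preimages: \<open>g y\<close> for a vertex,
  \<open>{g x, g y}\<close> for an edge. Edges must be pairs because homomorphisms are specified on
  pairs.\<close>

lemma rename_graph_iso:
  assumes "graph_hom f G H" "graph_hom g H G"
    and fg: "\<And>y. y \<in> verts H \<Longrightarrow> f (g y) = y"
    and G: "edges G \<subseteq> {{x, y} | x y. x \<in> verts G \<and> y \<in> verts G}"
    and H: "edges H \<subseteq> {{x, y} | x y. x \<in> verts H \<and> y \<in> verts H}"
  shows "rename f G = H"
proof -
  have "f ` verts G = verts H"
  proof
    show "f ` verts G \<subseteq> verts H"
      using assms(1) by (simp add: graph_hom_def image_subset_iff)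
    show "verts H \<subseteq> f ` verts G"
    proof
      fix y assume "y \<in> verts H"
      then show "y \<in> f ` verts G"
        using assms(2) fg by (intro image_eqI[of _ _ "g y"]) (simp_all add: graph_hom_def)
    qed
  qed
  moreover have "(`) f ` edges G = edges H"
  proof
    show "(`) f ` edges G \<subseteq> edges H"
    proof (rule image_subsetI)
      fix e assume e: "e \<in> edges G"
      then obtain x y where "e = {x, y}"
        using G by blast
      then show "f ` e \<in> edges H"
        using e assms(1) by (simp add: graph_hom_def)
    qed
    show "edges H \<subseteq> (`) f ` edges G"
    proof
      fix e assume e: "e \<in> edges H"
      then obtain x y where xy: "e = {x, y}" "x \<in> verts H" "y \<in> verts H"
        using H by blast
      then have "{g x, g y} \<in> edges G"
        using e assms(2) by (simp add: graph_hom_def)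
      moreover have "e = f ` {g x, g y}"
        using xy fg by simp
      ultimately show "e \<in> (`) f ` edges G"
        by (rule rev_image_eqI)
    qed
  qed
  ultimately show ?thesis
    by (cases H) (simp add: rename_def)
qed

text \<open>Each equation between \<open>F\<close> and its inverse \<open>F'\<close> has its task:
  \<open>F' (F A) = A\<close> yields injectivity, \<open>F (F' A) = A\<close> yields surjectivity on
  vertices and edges.\<close>

lemma graph_homeomorphism_nerve:
  assumes "graph_homeomorphism \<B> T \<C> U \<phi> F"
  shows "inj_on F (verts (nerve \<B>))" and "rename F (nerve \<B>) = nerve \<C>"
proof -
  obtain \<psi> F' where F': "graph_continuous \<C> U \<B> T \<psi> F'"
    "\<forall>A\<in>\<B>. F' (F A) = A" "\<forall>A\<in>\<C>. F (F' A) = A"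
    using assms unfolding graph_homeomorphism_def by blast
  then show "inj_on F (verts (nerve \<B>))"
    by (intro inj_on_inverseI[where g = F']) (simp add: nerve_def)
  show "rename F (nerve \<B>) = nerve \<C>"
  proof (rule rename_graph_iso)
    show "graph_hom F (nerve \<B>) (nerve \<C>)" "graph_hom F' (nerve \<C>) (nerve \<B>)"
      using assms F'(1) unfolding graph_homeomorphism_def graph_continuous_def by blast+
    show "F (F' A) = A" if "A \<in> verts (nerve \<C>)" for A
      using that F'(3) by (simp add: nerve_def)
  qed (auto simp: nerve_def)
qed

theorem theorem3:
  fixes G :: "'a graph" and H :: "'b graph"
  assumes "simple_graph G" and "simple_graph H"
    and "graph_homeomorphic G H"
  shows "graph_homotopic G H"
proof -
  obtain \<B> T \<C> U \<phi> F where "topological_graph G \<B> T" "topological_graph H \<C> U"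
    and hom: "graph_homeomorphism \<B> T \<C> U \<phi> F"
    using assms(3) unfolding graph_homeomorphic_def by blast
  then have G: "graph_homotopic (nerve \<B>) G" and H: "graph_homotopic (nerve \<C>) H"
    by (simp_all add: topological_graph_def)
  \<comment> \<open>\<open>nerve \<C>\<close> is a renamed copy of \<open>nerve \<B>\<close>, so the
    latter can serve as the middle graph between \<open>G\<close> and \<open>H\<close>.\<close>
  have "graph_homotopic (nerve \<B>) H"
    using graph_homeomorphism_nerve[OF hom] H by (metis graph_homotopic_rename_left)
  with graph_homotopic_sym[OF G] show ?thesis
    by (rule graph_homotopic_trans) (auto simp: nerve_def)
qed

end
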